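(* Let $A=A_{st}+A_{\mathcal I}\epsilon\in\mathbb{DQ}^{n\times n}$ be a Hermitian dual quaternion matrix with $A_{st}\ne O$. (i) If $\lambda_{st}$ is a simple right eigenvalue of $A_{st}$ with right eigenvector $\mathbf{x}_{st}$, then $\lambda=\lambda_{st}+\lambda_{\mathcal I}\epsilon$ is an eigenvalue of $A$, where $$\lambda_{\mathcal I}=\frac{\mathbf{x}_{st}^*A_{\mathcal I}\mathbf{x}_{st}}{\mathbf{x}_{st}^*\mathbf{x}_{st}}.$$ (ii) Furthermore, if $A_{st}$ has $n$ simple right eigenvalues $\lambda_{st,i}$ with associated unit right eigenvectors $\mathbf{x}_{st,i}$, $i=1,\cdots,n$, then $A$ has exactly $n$ eigenvalues $$\lambda_i=\lambda_{st,i}+\lambda_{\mathcal I,i}\epsilon,$$ with associated eigenvectors $\mathbf{x}_i=\mathbf{x}_{st,i}+\mathbf{x}_{\mathcal I,i}\epsilon$, $i=1,\cdots,n$, where $$\lambda_{\mathcal I,i}=\mathbf{x}_{st,i}^*A_{\mathcal I}\mathbf{x}_{st,i},\qquad \mathbf{x}_{\mathcal I,i}=\sum_{j\ne i}\frac{\mathbf{x}_{st,j}\mathbf{x}_{st,j}^*(A_{\mathcal I}-\lambda_{\mathcal I,i}I_n)\mathbf{x}_{st,i}}{\lambda_{st,i}-\lambda_{st,j}},\qquad i=1,\cdots,n.$$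
   Context: $\mathbb{Q}$ denotes the real quaternions and $q^*$ the quaternion conjugate. $\epsilon$ is the infinitesimal unit: $\epsilon\neq 0$, $\epsilon^2=0$, and $\epsilon$ commutes with all quaternions. A dual number is $q_{st}+q_{\mathcal I}\epsilon$ with $q_{st},q_{\mathcal I}\in\mathbb{R}$. A dual quaternion is $q=q_{st}+q_{\mathcal I}\epsilon$ with $q_{st},q_{\mathcal I}\in\mathbb{Q}$ (set $\mathbb{DQ}$), with conjugate $q^*=q_{st}^*+q_{\mathcal I}^*\epsilon$; it is appreciable if $q_{st}\ne0$. A vector in $\mathbb{DQ}^n$ is appreciable if at least one component is appreciable. A matrix over $\mathbb{DQ}$ is written $A=A_{st}+A_{\mathcal I}\epsilon$ with quaternion matrices $A_{st},A_{\mathcal I}$; $^*$ denotes conjugate transpose; $A$ is Hermitian if $A^*=A$ (equivalently $A_{st}$ and $A_{\mathcal I}$ are quaternion Hermitian). A unit vector satisfies $\mathbf{x}^*\mathbf{x}=1$. Right eigenvalue of a quaternion matrix $A_{st}$: $\lambda\in\mathbb{Q}$ with $A_{st}\mathbf{x}=\mathbf{x}\lambda$ for some nonzero $\mathbf{x}\in\mathbb{Q}^n$. A quaternion Hermitian matrix is diagonalizable by a quaternion unitary matrix with real diagonal entries, which are its right eigenvalues; a right eigenvalue is simple if it occurs exactly once on this diagonal. Eigenvalue of $A\in\mathbb{DQ}^{n\times n}$: a dual number $\lambda$ such that $A\mathbf{x}=\mathbf{x}\lambda$ for some appreciable $\mathbf{x}\in\mathbb{DQ}^n$ (an associated eigenvector).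 *)

theory Defs
  imports "HOL-Analysis.Analysis"
begin

section \<open>Quaternions\<close>

datatype quat = Quat (qre: real) (qi: real) (qj: real) (qk: real)

lemma quat_eq_iff: "p = q \<longleftrightarrow> qre p = qre q \<and> qi p = qi q \<and> qj p = qj q \<and> qk p = qk q"
  for p q :: quat
  by (auto intro: quat.expand)

instantiation quat :: real_div_algebra
begin

definition "0 = Quat 0 0 0 0"
definition "1 = Quat 1 0 0 0"
definition "p + q = Quat (qre p + qre q) (qi p + qi q) (qj p + qj q) (qk p + qk q)" for p q :: quat
definition "- p = Quat (- qre p) (- qi p) (- qj p) (- qk p)" for p :: quat
definition "p - q = Quat (qre p - qre q) (qi p - qi q) (qj p - qj q) (qk p - qk q)" for p q :: quat
definition "p * q = Quat
    (qre p * qre q - qi p * qi q - qj p * qj q - qk p * qk q)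
    (qre p * qi q + qi p * qre q + qj p * qk q - qk p * qj q)
    (qre p * qj q - qi p * qk q + qj p * qre q + qk p * qi q)
    (qre p * qk q + qi p * qj q - qj p * qi q + qk p * qre q)" for p q :: quat
definition "r *\<^sub>R p = Quat (r * qre p) (r * qi p) (r * qj p) (r * qk p)" for p :: quat
definition "inverse p =
    (let N = (qre p)\<^sup>2 + (qi p)\<^sup>2 + (qj p)\<^sup>2 + (qk p)\<^sup>2
     in Quat (qre p / N) (- qi p / N) (- qj p / N) (- qk p / N))" for p :: quat
definition "p div q = p * inverse q" for p q :: quat

lemmas quat_arith_defs = zero_quat_def one_quat_def plus_quat_def uminus_quat_def
  minus_quat_def times_quat_def scaleR_quat_def

instance
proof
  fix p :: quat
  assume "p \<noteq> 0"
  define N where "N = (qre p)\<^sup>2 + (qi p)\<^sup>2 + (qj p)\<^sup>2 + (qk p)\<^sup>2"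
  have "N \<noteq> 0"
  proof
    assume "N = 0"
    then have "(qre p)\<^sup>2 = 0 \<and> (qi p)\<^sup>2 = 0 \<and> (qj p)\<^sup>2 = 0 \<and> (qk p)\<^sup>2 = 0"
      unfolding N_def by (smt (verit) zero_le_power2)
    with \<open>p \<noteq> 0\<close> show False by (simp add: quat_eq_iff zero_quat_def)
  qed
  then have N: "(qre p * qre p + qi p * qi p + qj p * qj p + qk p * qk p) / N = 1"
    by (simp add: N_def power2_eq_square)
  have "inverse p = Quat (qre p / N) (- qi p / N) (- qj p / N) (- qk p / N)"
    by (simp add: inverse_quat_def Let_def N_def)
  then show "inverse p * p = 1" "p * inverse p = 1"
    using N by (simp_all add: times_quat_def one_quat_def add_divide_distrib mult.commute)
qed (simp_all add: quat_arith_defs quat_eq_iff divide_quat_def inverse_quat_def distrib_left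
  distrib_right left_diff_distrib right_diff_distrib)

end

section \<open>Dual extension of a ring\<close>

text \<open>\<open>Dual a b\<close> is \<open>a + b \<epsilon>\<close>, with standard part \<open>a\<close> and dual part \<open>b\<close>; dual quaternions are
  the type \<open>quat dual\<close>.\<close>

datatype 'a dual = Dual (st: 'a) (du: 'a)

lemma dual_eq_iff: "p = q \<longleftrightarrow> st p = st q \<and> du p = du q"
  by (auto intro: dual.expand)

instantiation dual :: (ring_1) ring_1
begin

definition "0 = Dual 0 0"
definition "1 = Dual 1 0"
definition "p + q = Dual (st p + st q) (du p + du q)" for p q :: "'a dual"
definition "- p = Dual (- st p) (- du p)" for p :: "'a dual"
definition "p - q = Dual (st p - st q) (du p - du q)" for p q :: "'a dual"
definition "p * q = Dual (st p * st q) (st p * du q + du p * st q)" for p q :: "'a dual"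

lemmas dual_arith_defs = zero_dual_def one_dual_def plus_dual_def uminus_dual_def
  minus_dual_def times_dual_def

instance
  by standard (simp_all add: dual_arith_defs dual_eq_iff algebra_simps)

end

lemma dual_unit:
  fixes q :: "'a::ring_1 dual"
  defines "\<epsilon> \<equiv> (Dual 0 1 :: 'a dual)"
  shows "\<epsilon> \<noteq> 0" "\<epsilon> * \<epsilon> = 0" "\<epsilon> * q = q * \<epsilon>" "q = Dual (st q) 0 + Dual (du q) 0 * \<epsilon>"
  by (simp_all add: \<epsilon>_def dual_arith_defs dual_eq_iff)

section \<open>Conjugation and conjugate transposes\<close>

class conj_ring = ring_1 +
  fixes conjg :: "'a \<Rightarrow> 'a"
  assumes conjg_add: "conjg (x + y) = conjg x + conjg y"
    and conjg_mult: "conjg (x * y) = conjg y * conjg x"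
    and conjg_conjg: "conjg (conjg x) = x"

instantiation quat :: conj_ring
begin
definition "conjg p = Quat (qre p) (- qi p) (- qj p) (- qk p)"
instance
  by standard (simp_all add: conjg_quat_def quat_arith_defs quat_eq_iff)
end

instantiation dual :: (conj_ring) conj_ring
begin
definition "conjg p = Dual (conjg (st p)) (conjg (du p))"
instance
  by standard (simp_all add: conjg_dual_def dual_arith_defs dual_eq_iff conjg_add conjg_mult conjg_conjg
    algebra_simps)
end

definition ctranspose :: "'a::conj_ring ^ 'n ^ 'm \<Rightarrow> 'a ^ 'm ^ 'n" where
  "ctranspose A = (\<chi> i j. conjg (A $ j $ i))"

definition hermitian :: "'a::conj_ring ^ 'n ^ 'n \<Rightarrow> bool" where
  "hermitian A \<longleftrightarrow> ctranspose A = A"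

definition unitary :: "'a::conj_ring ^ 'n ^ 'n \<Rightarrow> bool" where
  "unitary U \<longleftrightarrow> ctranspose U ** U = mat 1 \<and> U ** ctranspose U = mat 1"

text \<open>For column vectors \<open>x\<close>, \<open>y\<close>: \<open>cdot x y\<close> is the scalar \<open>x\<^sup>* y\<close>, \<open>outer x y\<close> the matrix
  \<open>x y\<^sup>*\<close>, and \<open>rscale x q\<close> the vector \<open>x q\<close>.\<close>

definition cdot :: "'a::conj_ring ^ 'n \<Rightarrow> 'a ^ 'n \<Rightarrow> 'a" where
  "cdot x y = (\<Sum>k\<in>UNIV. conjg (x $ k) * y $ k)"

definition outer :: "'a::conj_ring ^ 'm \<Rightarrow> 'a ^ 'n \<Rightarrow> 'a ^ 'n ^ 'm" where
  "outer x y = (\<chi> i j. x $ i * conjg (y $ j))"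

definition rscale :: "'a::ring_1 ^ 'n \<Rightarrow> 'a \<Rightarrow> 'a ^ 'n" where
  "rscale x q = (\<chi> k. x $ k * q)"

section \<open>Right eigenvalues of quaternion matrices\<close>

definition right_eigenpair :: "quat ^ 'n ^ 'n \<Rightarrow> quat \<Rightarrow> quat ^ 'n \<Rightarrow> bool" where
  "right_eigenpair M l x \<longleftrightarrow> x \<noteq> 0 \<and> M *v x = rscale x l"

definition right_eigenvalue :: "quat ^ 'n ^ 'n \<Rightarrow> quat \<Rightarrow> bool" where
  "right_eigenvalue M l \<longleftrightarrow> (\<exists>x. right_eigenpair M l x)"

definition diagonalizes :: "quat ^ 'n ^ 'n \<Rightarrow> quat ^ 'n ^ 'n \<Rightarrow> ('n \<Rightarrow> real) \<Rightarrow> bool" where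
  "diagonalizes M U d \<longleftrightarrow>
     unitary U \<and> ctranspose U ** M ** U = (\<chi> i j. if i = j then of_real (d i) else 0)"

text \<open>Only used for Hermitian matrices, which always have a unitary diagonalization. The choice of
  diagonalization is irrelevant, see \<open>simple_right_eigenvalue_iff\<close> below.\<close>

definition simple_right_eigenvalue :: "quat ^ 'n ^ 'n \<Rightarrow> quat \<Rightarrow> bool" where
  "simple_right_eigenvalue M l \<longleftrightarrow> right_eigenvalue M l \<and>
     (\<exists>U d. diagonalizes M U d \<and> (\<exists>!i. of_real (d i) = l))"

lemma diagonalizes_entry_once:
  fixes M :: "quat ^ 'n ^ 'n"
  assumes U: "diagonalizes M U d" and V: "diagonalizes M V e"
    and once: "\<exists>!i. of_real (d i) = l"
  shows "\<exists>!j. of_real (e j) = l"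
proof -
  define D where "D = (\<chi> i j. if i = j then of_real (d i) else (0::quat))"
  define E where "E = (\<chi> i j. if i = j then of_real (e i) else (0::quat))"
  define W where "W = ctranspose U ** V"
  have U1: "ctranspose U ** U = mat 1" "U ** ctranspose U = mat 1" "ctranspose U ** M ** U = D"
    using U by (auto simp: diagonalizes_def unitary_def D_def)
  have V1: "ctranspose V ** V = mat 1" "V ** ctranspose V = mat 1" "ctranspose V ** M ** V = E"
    using V by (auto simp: diagonalizes_def unitary_def E_def)
  have "D ** W = ctranspose U ** M ** (U ** ctranspose U) ** V"
    by (simp add: U1(3)[symmetric] W_def matrix_mul_assoc)
  also have "\<dots> = ctranspose U ** (V ** ctranspose V) ** M ** V" by (simp add: U1 V1)
  also have "\<dots> = W ** E"
    by (simp add: V1(3)[symmetric] W_def matrix_mul_assoc)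
  finally have DWE: "(D ** W) $ i $ j = (W ** E) $ i $ j" for i j by simp
  then have DE: "of_real (d i) * W $ i $ j = W $ i $ j * of_real (e j)" for i j
  proof -
    have "(D ** W) $ i $ j = (\<Sum>k\<in>UNIV. if i = k then of_real (d i) * W $ k $ j else 0)"
      unfolding matrix_matrix_mult_def D_def vec_lambda_beta by (rule sum.cong) auto
    moreover have "(W ** E) $ i $ j = (\<Sum>k\<in>UNIV. if k = j then W $ i $ k * of_real (e j) else 0)"
      unfolding matrix_matrix_mult_def E_def vec_lambda_beta by (rule sum.cong) auto
    ultimately show ?thesis using DWE[of i j] by simp
  qed
  have com: "of_real r * q = q * of_real r" for r and q :: quat
    by (simp add: of_real_def)
  have zero: "d i = e j" if "W $ i $ j \<noteq> 0" for i j
  proof -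
    have "W $ i $ j * (of_real (d i) - of_real (e j)) = 0"
      using DE[of i j] com[of "d i"] by (simp add: right_diff_distrib)
    with that show ?thesis by simp
  qed
  have W1: "ctranspose W = ctranspose V ** U"
  proof -
    have sum: "conjg (sum f S) = (\<Sum>k\<in>S. conjg (f k))" if "finite S" for f :: "'n \<Rightarrow> quat" and S
      using that by (induction S rule: finite_induct)
        (simp_all add: conjg_add, simp add: conjg_quat_def zero_quat_def)
    show ?thesis
      by (simp add: W_def ctranspose_def matrix_matrix_mult_def vec_eq_iff sum conjg_mult conjg_conjg)
  qed
  have "ctranspose W ** W = ctranspose V ** (U ** ctranspose U) ** V"
    unfolding W1 by (simp add: W_def matrix_mul_assoc)
  then have "ctranspose W ** W = mat 1" by (simp add: U1 V1)
  then have cols: "(\<Sum>k\<in>UNIV. conjg (W $ k $ i) * W $ k $ j) = (if i = j then 1 else 0)" for i j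
    by (simp add: vec_eq_iff matrix_matrix_mult_def ctranspose_def mat_def)
  have "W ** ctranspose W = ctranspose U ** (V ** ctranspose V) ** U"
    unfolding W1 by (simp add: W_def matrix_mul_assoc)
  then have "W ** ctranspose W = mat 1" by (simp add: U1 V1)
  then have rows: "(\<Sum>k\<in>UNIV. W $ i $ k * conjg (W $ j $ k)) = (if i = j then 1 else 0)" for i j
    by (simp add: vec_eq_iff matrix_matrix_mult_def ctranspose_def mat_def)
  obtain i where i: "of_real (d i) = l" and uniq: "\<And>k. of_real (d k) = l \<Longrightarrow> k = i"
    using once by auto
  have "\<exists>j. W $ i $ j \<noteq> 0"
  proof (rule ccontr)
    assume "\<nexists>j. W $ i $ j \<noteq> 0"
    then have "\<And>k. W $ i $ k = 0" by blast
    with rows[of i i] show False by simp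
  qed
  then obtain j where j: "of_real (e j) = l" using zero i by metis
  moreover have "j' = j" if "of_real (e j') = l" for j'
  proof (rule ccontr)
    assume ne: "j' \<noteq> j"
    have off: "W $ k $ j = 0" "W $ k $ j' = 0" if "k \<noteq> i" for k
      using uniq that zero j \<open>of_real (e j') = l\<close> by metis+
    have conj0: "conjg (0::quat) = 0" by (simp add: conjg_quat_def zero_quat_def)
    have red: "conjg (W $ i $ a) * W $ i $ b = (\<Sum>k\<in>UNIV. conjg (W $ k $ a) * W $ k $ b)"
      if "a \<in> {j, j'}" "b \<in> {j, j'}" for a b
      using that off by (subst sum.remove[of _ i]) (auto intro!: sum.neutral simp: conj0, (use off in blast)+)
    have "conjg (W $ i $ j) * W $ i $ j' = 0" "conjg (W $ i $ j) * W $ i $ j = 1"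
      "conjg (W $ i $ j') * W $ i $ j' = 1"
      using ne by (simp_all add: red cols)
    then show False by (metis mult_eq_0_iff zero_neq_one)
  qed
  ultimately show ?thesis by blast
qed

lemma simple_right_eigenvalue_iff:
  fixes M :: "quat ^ 'n ^ 'n"
  assumes "diagonalizes M U d"
  shows "simple_right_eigenvalue M l \<longleftrightarrow> right_eigenvalue M l \<and> (\<exists>!i. of_real (d i) = l)"
proof
  assume "simple_right_eigenvalue M l"
  then obtain V e where "right_eigenvalue M l" "diagonalizes M V e" "\<exists>!i. of_real (e i) = l"
    unfolding simple_right_eigenvalue_def by (elim conjE exE)
  with diagonalizes_entry_once[OF _ assms] show "right_eigenvalue M l \<and> (\<exists>!i. of_real (d i) = l)"
    by simp
next
  assume "right_eigenvalue M l \<and> (\<exists>!i. of_real (d i) = l)"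
  with assms show "simple_right_eigenvalue M l"
    unfolding simple_right_eigenvalue_def by (intro conjI exI[of _ U] exI[of _ d]) simp_all
qed

section \<open>Dual quaternion vectors and matrices\<close>

definition dual_number :: "quat dual \<Rightarrow> bool" where
  "dual_number q \<longleftrightarrow> st q \<in> \<real> \<and> du q \<in> \<real>"

definition appreciable :: "quat dual \<Rightarrow> bool" where
  "appreciable q \<longleftrightarrow> st q \<noteq> 0"

definition appreciable_vec :: "quat dual ^ 'n \<Rightarrow> bool" where
  "appreciable_vec x \<longleftrightarrow> (\<exists>k. appreciable (x $ k))"

definition dual_vec :: "'a ^ 'n \<Rightarrow> 'a ^ 'n \<Rightarrow> 'a dual ^ 'n" where
  "dual_vec x y = (\<chi> k. Dual (x $ k) (y $ k))"

definition eigenpair :: "quat dual ^ 'n ^ 'n \<Rightarrow> quat dual \<Rightarrow> quat dual ^ 'n \<Rightarrow> bool" where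
  "eigenpair A l x \<longleftrightarrow> dual_number l \<and> appreciable_vec x \<and> A *v x = rscale x l"

definition eigenvalue :: "quat dual ^ 'n ^ 'n \<Rightarrow> quat dual \<Rightarrow> bool" where
  "eigenvalue A l \<longleftrightarrow> (\<exists>x. eigenpair A l x)"

end

theory Submission
  imports Defs
begin

text \<open>Expand in an orthonormal basis of eigenvectors of the standard part. The dual part of
  \<open>A x = x \<lambda>\<close> reads \<open>A\<^sub>s\<^sub>t y + w = y \<lambda>\<^sub>s\<^sub>t\<close> with \<open>w = A\<^sub>I x\<^sub>s\<^sub>t - x\<^sub>s\<^sub>t \<lambda>\<^sub>I\<close> and \<open>y = x\<^sub>I\<close>. If
  \<open>\<lambda>\<^sub>s\<^sub>t\<close> is simple, this is solvable iff the component of \<open>w\<close> along the eigenvector \<open>x\<^sub>s\<^sub>t\<close>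
  vanishes, which determines \<open>\<lambda>\<^sub>I\<close>; dividing the other components by the gaps gives \<open>x\<^sub>I\<close>.\<close>

section \<open>Real scalars and conjugation in the quaternions\<close>

lemma of_real_quat_commute: "of_real r * q = q * of_real r" for q :: quat
  by (simp add: of_real_def)

lemma Reals_quat_commute: "a \<in> \<real> \<Longrightarrow> a * q = q * a" for q :: quat
  by (auto elim!: Reals_cases simp: of_real_quat_commute)

lemma conjg_zero [simp]: "conjg 0 = (0::'a::conj_ring)"
  by (metis add_cancel_right_right conjg_add)

lemma conjg_sum: "conjg (sum f S) = (\<Sum>k\<in>S. conjg (f k))" for f :: "'b \<Rightarrow> 'a::conj_ring"
  by (induction S rule: infinite_finite_induct) (simp_all add: conjg_add)

lemma conjg_of_real [simp]: "conjg (of_real r :: quat) = of_real r"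
  by (simp add: of_real_def quat_arith_defs conjg_quat_def)

lemma conjg_eq_self_iff: "conjg q = q \<longleftrightarrow> q \<in> \<real>" for q :: quat
proof
  assume "conjg q = q"
  then have "q = of_real (qre q)"
    by (simp add: quat_eq_iff conjg_quat_def of_real_def quat_arith_defs)
  then show "q \<in> \<real>" by (metis Reals_of_real)
qed (auto elim!: Reals_cases)

lemma conjg_eq_zero_iff [simp]: "conjg q = 0 \<longleftrightarrow> q = 0" for q :: quat
  by (metis conjg_conjg conjg_zero)

section \<open>Calculus of the product \<open>cdot\<close>, right scaling and matrix action\<close>

lemma cdot_rscale: "cdot x (rscale y q) = cdot x y * q"
  by (simp add: cdot_def rscale_def sum_distrib_right mult.assoc)

lemma cdot_rscale_left: "cdot (rscale x q) y = conjg q * cdot x y"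
  by (simp add: cdot_def rscale_def sum_distrib_left mult.assoc conjg_mult)

lemma cdot_add: "cdot x (y + z) = cdot x y + cdot x z"
  by (simp add: cdot_def distrib_left sum.distrib)

lemma cdot_diff: "cdot x (y - z) = cdot x y - cdot x z"
  by (simp add: cdot_def right_diff_distrib sum_subtractf)

lemma cdot_zero [simp]: "cdot x 0 = 0"
  by (simp add: cdot_def)

lemma cdot_sum: "cdot x (sum f S) = (\<Sum>k\<in>S. cdot x (f k))"
  by (induction S rule: infinite_finite_induct) (simp_all add: cdot_add)

lemma conjg_cdot: "conjg (cdot x y) = cdot y x"
  by (simp add: cdot_def conjg_sum conjg_mult conjg_conjg)

lemma cdot_matrix_vector_mult: "cdot x (A *v y) = cdot (ctranspose A *v x) y"
proof -
  have "cdot x (A *v y) = (\<Sum>i\<in>UNIV. \<Sum>j\<in>UNIV. conjg (x $ i) * A $ i $ j * y $ j)"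
    by (simp add: cdot_def matrix_vector_mult_def sum_distrib_left mult.assoc)
  also have "\<dots> = cdot (ctranspose A *v x) y"
    by (subst sum.swap) (simp add: cdot_def matrix_vector_mult_def ctranspose_def
      sum_distrib_right conjg_sum conjg_mult conjg_conjg)
  finally show ?thesis .
qed

lemma hermitian_cdot: "hermitian A \<Longrightarrow> cdot x (A *v y) = cdot (A *v x) y"
  by (simp add: cdot_matrix_vector_mult hermitian_def)

text \<open>The value is its own conjugate, and only reals are. So it may serve as the dual part of
  a dual number, and it commutes with all quaternion factors.\<close>

lemma hermitian_cdot_real: "hermitian A \<Longrightarrow> cdot x (A *v x) \<in> \<real>"
  for A :: "quat ^ 'n ^ 'n"
  unfolding conjg_eq_self_iff[symmetric] by (simp add: conjg_cdot hermitian_cdot)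

lemma matrix_vector_mult_rscale: "A *v rscale x q = rscale (A *v x) q"
  by (simp add: vec_eq_iff matrix_vector_mult_def rscale_def sum_distrib_right mult.assoc)

lemma matrix_vector_mult_sum: "A *v (sum f S) = (\<Sum>k\<in>S. A *v f k)" for A :: "'a::ring_1 ^ 'n ^ 'm"
  by (induction S rule: infinite_finite_induct) (simp_all add: matrix_vector_right_distrib)

lemma rscale_rscale: "rscale (rscale x p) q = rscale x (p * q)"
  by (simp add: rscale_def mult.assoc)

lemma rscale_zero [simp]: "rscale x 0 = 0"
  by (simp add: rscale_def vec_eq_iff)

lemma outer_mult: "outer x y *v z = rscale x (cdot y z)"
  by (simp add: vec_eq_iff outer_def matrix_vector_mult_def rscale_def cdot_def
    sum_distrib_left mult.assoc)

text \<open>\<open>mat b\<close> scales entries from the left, \<open>rscale\<close> from the right;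
  a real \<open>b\<close> is central, so the two agree.\<close>

lemma matrix_sub_mat_mult:
  fixes A :: "quat ^ 'n ^ 'n"
  assumes "b \<in> \<real>"
  shows "(A - mat b) *v x = A *v x - rscale x b"
proof -
  have "(mat b *v x) $ i = b * x $ i" for i
    by (simp add: matrix_vector_mult_def mat_def if_distrib[of "\<lambda>c. c * _"] cong: if_cong)
  then have "mat b *v x = rscale x b"
    by (simp add: vec_eq_iff rscale_def Reals_quat_commute[OF assms])
  moreover have "(A - mat b) *v x = A *v x - mat b *v x"
    by (simp add: vec_eq_iff matrix_vector_mult_def left_diff_distrib sum_subtractf)
  ultimately show ?thesis by simp
qed

lemma ctranspose_mult_nth: "(ctranspose A ** B) $ i $ j = cdot (column i A) (column j B)"
  by (simp add: matrix_matrix_mult_def ctranspose_def cdot_def column_def)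

lemma mult_ctranspose_mult: "(A ** ctranspose B) *v x = (\<Sum>j\<in>UNIV. rscale (column j A) (cdot (column j B) x))"
  by (simp add: vec_eq_iff matrix_vector_mul_assoc[symmetric])
     (simp add: matrix_vector_mult_def ctranspose_def rscale_def cdot_def column_def)

section \<open>Orthonormal eigenbases\<close>

text \<open>Completeness stands beside orthonormality as an axiom, so that the coordinates
  \<open>cdot (x j) v\<close> determine \<open>v\<close> without any dimension count.\<close>

locale eigenbasis =
  fixes M :: "quat ^ 'n ^ 'n" and x :: "'n \<Rightarrow> quat ^ 'n" and d :: "'n \<Rightarrow> real"
  assumes orth: "cdot (x i) (x j) = (if i = j then 1 else 0)"
    and complete: "(\<Sum>j\<in>UNIV. rscale (x j) (cdot (x j) v)) = v"
    and eigen: "M *v x i = rscale (x i) (of_real (d i))"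
begin

lemma cdot_basis_sum: "cdot (x i) (\<Sum>j\<in>S. rscale (x j) (c j)) = (if i \<in> S then c i else 0)"
proof -
  have "cdot (x i) (\<Sum>j\<in>S. rscale (x j) (c j)) = (\<Sum>j\<in>S. if i = j then c j else 0)"
    unfolding cdot_sum by (intro sum.cong refl) (simp add: cdot_rscale orth)
  then show ?thesis by simp
qed

lemma vec_eqI: "(\<And>j. cdot (x j) v = cdot (x j) w) \<Longrightarrow> v = w"
  by (metis (no_types, lifting) complete sum.cong)

text \<open>Applying \<open>M\<close> termwise to the expansion of \<open>v\<close> shows that
  \<open>M\<close> is diagonal in these coordinates.\<close>

lemma cdot_eigen: "cdot (x j) (M *v v) = of_real (d j) * cdot (x j) v"
proof -
  have "M *v v = (\<Sum>k\<in>UNIV. rscale (x k) (of_real (d k) * cdot (x k) v))"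
    by (subst (1) complete[of v, symmetric])
       (simp add: matrix_vector_mult_sum matrix_vector_mult_rscale eigen rscale_rscale)
  then show ?thesis by (simp add: cdot_basis_sum)
qed

text \<open>Comparing \<open>j\<close>-th coordinates makes the product of
  \<open>cdot (x j) v\<close> and \<open>d j - a\<close> zero, and quaternions have no zero
  divisors.\<close>

lemma eigenvector_coeff:
  assumes "M *v v = rscale v (of_real a)" and "cdot (x j) v \<noteq> 0"
  shows "d j = a"
proof -
  have "of_real (d j) * cdot (x j) v = cdot (x j) v * of_real a"
    using arg_cong[OF assms(1), of "cdot (x j)"] by (simp add: cdot_eigen cdot_rscale)
  then have "cdot (x j) v * (of_real (d j) - of_real a) = 0"
    by (simp add: of_real_quat_commute right_diff_distrib)
  with assms(2) show ?thesis by simp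
qed

lemma real_eigenvalue_in_range:
  assumes "M *v v = rscale v (of_real a)" and "v \<noteq> 0"
  shows "a \<in> range d"
proof -
  obtain j where "cdot (x j) v \<noteq> 0"
    using assms(2) vec_eqI[of v 0] by auto
  then show ?thesis using eigenvector_coeff[OF assms(1)] by blast
qed

text \<open>By \<open>eigenvector_coeff\<close>, every coordinate of \<open>v\<close> except the
  \<open>i\<close>-th vanishes.\<close>

lemma simple_eigenvector:
  assumes "\<And>j. d j = d i \<Longrightarrow> j = i" and v: "M *v v = rscale v (of_real (d i))"
  shows "v = rscale (x i) (cdot (x i) v)"
proof (rule vec_eqI)
  show "cdot (x j) v = cdot (x j) (rscale (x i) (cdot (x i) v))" for j
    using assms(1)[of j] eigenvector_coeff[OF v, of j] by (auto simp: cdot_rscale orth)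
qed

text \<open>The \<open>j\<close>-th coordinate of the equation says that \<open>cdot (x j) y\<close>
  times the gap \<open>d i - d j\<close> equals \<open>cdot (x j) w\<close>. For \<open>j\<close>
  other than \<open>i\<close> the gap is invertible; for \<open>j = i\<close> both sides are zero,
  and the free \<open>i\<close>-th coordinate of \<open>y\<close> is chosen to be zero.\<close>

lemma first_order_solution:
  assumes "\<And>j. d j = d i \<Longrightarrow> j = i" and "cdot (x i) w = 0"
  defines "y \<equiv> \<Sum>j\<in>UNIV - {i}. rscale (x j) (cdot (x j) w * inverse (of_real (d i) - of_real (d j)))"
  shows "M *v y + w = rscale y (of_real (d i))"
proof (rule vec_eqI)
  fix j
  have y: "cdot (x j) y = (if j \<noteq> i then cdot (x j) w * inverse (of_real (d i) - of_real (d j)) else 0)"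
    by (simp add: y_def cdot_basis_sum)
  have "cdot (x j) y * (of_real (d i) - of_real (d j)) = cdot (x j) w"
  proof (cases "j = i")
    case False
    then have "of_real (d i) - of_real (d j) \<noteq> (0::quat)"
      using assms(1)[of j] by auto
    with False show ?thesis by (simp add: y mult.assoc)
  qed (simp add: y assms(2))
  then show "cdot (x j) (M *v y + w) = cdot (x j) (rscale y (of_real (d i)))"
    by (simp add: cdot_add cdot_eigen cdot_rscale right_diff_distrib of_real_quat_commute
      algebra_simps)
qed

text \<open>Pairing the last equation with \<open>x i\<close> cancels the two terms in
  \<open>y\<close>. Since \<open>v\<close> is \<open>x i\<close> times some nonzero
  \<open>c\<close>, what remains is \<open>c * cdot (x i) (B *v x i) = c * b\<close>, once the real
  value is moved past \<open>c\<close>.\<close>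

lemma first_order_value:
  assumes "\<And>j. d j = d i \<Longrightarrow> j = i" and B: "hermitian B" and "v \<noteq> 0"
    and v: "M *v v = rscale v (of_real (d i))"
    and y: "M *v y + B *v v = rscale v b + rscale y (of_real (d i))"
  shows "b = cdot (x i) (B *v x i)"
proof -
  define c where "c = cdot (x i) v"
  have vc: "v = rscale (x i) c"
    unfolding c_def by (rule simple_eigenvector[OF assms(1) v])
  have "c \<noteq> 0" using \<open>v \<noteq> 0\<close> vc by auto
  have "cdot (x i) (B *v v) = c * b"
    using arg_cong[OF y, of "cdot (x i)"]
    by (simp add: cdot_add cdot_eigen cdot_rscale of_real_quat_commute c_def)
  moreover have "cdot (x i) (B *v v) = c * cdot (x i) (B *v x i)"
    by (simp add: vc matrix_vector_mult_rscale cdot_rscale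
      Reals_quat_commute[OF hermitian_cdot_real[OF B]])
  ultimately show ?thesis using \<open>c \<noteq> 0\<close> by simp
qed

end

text \<open>The two halves of unitarity give orthonormality and completeness of the columns; the
  eigenvector equations are \<open>M ** U = U ** D\<close>, with \<open>D\<close> the diagonal
  matrix, read column by column.\<close>

lemma diagonalizes_eigenbasis:
  assumes "diagonalizes M U d"
  shows "eigenbasis M (\<lambda>i. column i U) d"
proof
  have U: "ctranspose U ** U = mat 1" "U ** ctranspose U = mat 1"
    and D: "ctranspose U ** M ** U = (\<chi> i j. if i = j then of_real (d i) else 0)"
    using assms by (auto simp: diagonalizes_def unitary_def)
  show "cdot (column i U) (column j U) = (if i = j then 1 else 0)" for i j
    by (simp add: ctranspose_mult_nth[symmetric] U mat_def)
  show "(\<Sum>j\<in>UNIV. rscale (column j U) (cdot (column j U) v)) = v" for v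
    by (simp add: mult_ctranspose_mult[symmetric] U)
  show "M *v column i U = rscale (column i U) (of_real (d i))" for i
  proof -
    have "M ** U = U ** (ctranspose U ** M ** U)"
      by (simp add: matrix_mul_assoc U)
    then have "column i (M ** U) = column i (U ** (\<chi> i j. if i = j then of_real (d i) else 0))"
      by (simp add: D)
    then show ?thesis
      by (simp add: vec_eq_iff column_def rscale_def matrix_matrix_mult_def matrix_vector_mult_def
        if_distrib[of "(*) _"] cong: if_cong)
  qed
qed

text \<open>Completeness of \<open>z\<close> comes from that of \<open>x\<close>, which avoids dimension theory over the
  quaternions: each \<open>z i\<close> is a unit multiple of some \<open>x (s i)\<close>, and the injection \<open>s\<close> is onto.\<close>

lemma (in eigenbasis) distinct_eigenvectors_eigenbasis:
  assumes "inj e" and e: "\<And>i. M *v z i = rscale (z i) (of_real (e i))"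
    and unit: "\<And>i. cdot (z i) (z i) = 1"
  shows "eigenbasis M z e"
proof
  have nz: "z i \<noteq> 0" for i using unit[of i] by auto
  then have "\<forall>i. \<exists>k. d k = e i"
    using real_eigenvalue_in_range[OF e] by (metis imageE)
  then obtain s where s: "\<And>i. d (s i) = e i" by metis
  have "inj s" using \<open>inj e\<close> s by (metis injI inj_eq)
  then have bij: "bij s" by (simp add: bij_def finite_UNIV_inj_surj)
  \<comment> \<open>Every index is some \<open>s k\<close>, where \<open>d\<close> takes the value
    \<open>e k\<close>; so injectivity of \<open>e\<close> makes all values of \<open>d\<close>
    simple.\<close>
  have simp: "j = s i" if "d j = d (s i)" for i j
    using that bij \<open>inj e\<close> s by (metis bij_pointE inj_eq)
  define c where "c i = cdot (x (s i)) (z i)" for i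
  have z: "z i = rscale (x (s i)) (c i)" for i
    unfolding c_def by (rule simple_eigenvector) (use simp e s in auto)
  have cc: "conjg (c i) * c i = 1" for i
    using unit[of i] by (simp add: z cdot_rscale cdot_rscale_left orth)
  \<comment> \<open>A left inverse in a division ring is also a right inverse; this order of factors
    occurs when projecting onto \<open>z j\<close>.\<close>
  then have cc': "c i * conjg (c i) = 1" for i
    by (metis inverse_unique left_inverse right_inverse mult_zero_left zero_neq_one)
  show "cdot (z i) (z j) = (if i = j then 1 else 0)" for i j
    using \<open>inj s\<close> cc by (auto simp: z cdot_rscale cdot_rscale_left orth inj_eq)
  show "(\<Sum>j\<in>UNIV. rscale (z j) (cdot (z j) v)) = v" for v
  proof -
    \<comment> \<open>The unit factor \<open>c j\<close> cancels, so \<open>z j\<close> and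
      \<open>x (s j)\<close> have the same projection.\<close>
    have "rscale (z j) (cdot (z j) v) = rscale (x (s j)) (cdot (x (s j)) v)" for j
      by (simp add: z cdot_rscale_left rscale_rscale mult.assoc[symmetric] cc')
    then show ?thesis
      using sum.reindex_bij_betw[OF bij, of "\<lambda>k. rscale (x k) (cdot (x k) v)"] by (simp add: complete)
  qed
qed (fact e)

section \<open>Eigenvalues of dual quaternion matrices\<close>

lemma st_sum: "st (sum f S) = (\<Sum>k\<in>S. st (f k))" for f :: "'b \<Rightarrow> 'a::ring_1 dual"
  by (induction S rule: infinite_finite_induct) (simp_all add: dual_arith_defs)

lemma du_sum: "du (sum f S) = (\<Sum>k\<in>S. du (f k))" for f :: "'b \<Rightarrow> 'a::ring_1 dual"
  by (induction S rule: infinite_finite_induct) (simp_all add: dual_arith_defs)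

lemma hermitian_map_matrix:
  fixes A :: "'a::conj_ring dual ^ 'n ^ 'n"
  assumes "hermitian A"
  shows "hermitian (map_matrix st A)" and "hermitian (map_matrix du A)"
  using assms by (simp_all add: hermitian_def ctranspose_def vec_eq_iff conjg_dual_def
    dual_eq_iff)

lemma dual_vec_cases: obtains v y where "x = dual_vec v y"
proof
  show "x = dual_vec (\<chi> k. st (x $ k)) (\<chi> k. du (x $ k))"
    by (simp add: dual_vec_def vec_eq_iff)
qed

text \<open>Compare standard and dual parts: the product of two dual parts drops out because the
  infinitesimal unit squares to zero. Appreciability becomes \<open>v \<noteq> 0\<close>.\<close>

lemma eigenpair_dual_vec:
  "eigenpair A (Dual a b) (dual_vec v y) \<longleftrightarrow> a \<in> \<real> \<and> b \<in> \<real> \<and> v \<noteq> 0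
     \<and> map_matrix st A *v v = rscale v a
     \<and> map_matrix st A *v y + map_matrix du A *v v = rscale v b + rscale y a"
  by (auto simp: eigenpair_def dual_number_def appreciable_vec_def appreciable_def dual_vec_def
    vec_eq_iff matrix_vector_mult_def rscale_def dual_eq_iff st_sum du_sum times_dual_def
    sum.distrib)

section \<open>Lifting simple right eigenvalues to dual eigenvalues\<close>

lemma simple_right_eigenvalue_eigenvalue:
  fixes A :: "quat dual ^ 'n ^ 'n"
  assumes "hermitian A" and "simple_right_eigenvalue (map_matrix st A) l"
    and v: "right_eigenpair (map_matrix st A) l v"
  shows "eigenvalue A (Dual l (cdot v (map_matrix du A *v v) / cdot v v))"
proof -
  let ?M = "map_matrix st A" and ?B = "map_matrix du A"
  obtain U d where U: "diagonalizes ?M U d" and ex1: "\<exists>!i. of_real (d i) = l"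
    using assms(2) unfolding simple_right_eigenvalue_def by blast
  then obtain i where l: "of_real (d i) = l" by blast
  have uniq: "j = i" if "d j = d i" for j
    using ex1 l that by metis
  define x where "x = (\<lambda>i. column i U)"
  interpret eigenbasis ?M x d
    unfolding x_def by (rule diagonalizes_eigenbasis[OF U])
  define c where "c = cdot (x i) v"
  define b where "b = cdot (x i) (?B *v x i)"
  have Mv: "?M *v v = rscale v (of_real (d i))" and "v \<noteq> 0"
    using v l by (auto simp: right_eigenpair_def)
  then have vc: "v = rscale (x i) c"
    unfolding c_def by (intro simple_eigenvector[OF uniq])
  with \<open>v \<noteq> 0\<close> have "c \<noteq> 0" by auto
  have b: "b \<in> \<real>"
    unfolding b_def by (intro hermitian_cdot_real hermitian_map_matrix assms(1))
  \<comment> \<open>With \<open>v\<close> equal to \<open>x i\<close> times \<open>c\<close>, the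
    left side is \<open>conjg c * b * c\<close>, and the real \<open>b\<close> moves to the
    front.\<close>
  have "cdot v (?B *v v) = b * cdot v v"
    by (simp add: vc matrix_vector_mult_rscale cdot_rscale cdot_rscale_left orth mult.assoc
      Reals_quat_commute[OF b] flip: b_def)
  moreover have "cdot v v \<noteq> 0"
    using \<open>c \<noteq> 0\<close> by (simp add: vc cdot_rscale cdot_rscale_left orth)
  ultimately have quot: "cdot v (?B *v v) / cdot v v = b"
    by (simp add: divide_inverse mult.assoc)
  \<comment> \<open>This is the solvability condition for the dual part of the eigenvector.\<close>
  have "cdot (x i) (?B *v v - rscale v b) = 0"
    by (simp add: vc cdot_diff matrix_vector_mult_rscale cdot_rscale orth
      Reals_quat_commute[OF b] flip: b_def)
  from first_order_solution[OF uniq this]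
  obtain y where "?M *v y + (?B *v v - rscale v b) = rscale y (of_real (d i))" by blast
  then have "?M *v y + ?B *v v = rscale v b + rscale y (of_real (d i))"
    by (simp add: algebra_simps)
  with Mv b \<open>v \<noteq> 0\<close> have "eigenpair A (Dual l b) (dual_vec v y)"
    by (auto simp: eigenpair_dual_vec simp flip: l)
  then show ?thesis unfolding quot eigenvalue_def by blast
qed

lemma simple_right_eigenvalues_eigenvalues:
  fixes A :: "quat dual ^ 'n ^ 'n" and l :: "'n \<Rightarrow> quat" and x :: "'n \<Rightarrow> quat ^ 'n"
  assumes "hermitian A" and "inj l"
    and simple: "\<And>i. simple_right_eigenvalue (map_matrix st A) (l i)"
    and x: "\<And>i. right_eigenpair (map_matrix st A) (l i) (x i)"
    and unit: "\<And>i. cdot (x i) (x i) = 1"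
  defines "b \<equiv> \<lambda>i. cdot (x i) (map_matrix du A *v x i)"
  defines "y \<equiv> \<lambda>i. \<Sum>j\<in>UNIV - {i}.
    rscale (outer (x j) (x j) *v ((map_matrix du A - mat (b i)) *v x i)) (inverse (l i - l j))"
  shows "eigenpair A (Dual (l i) (b i)) (dual_vec (x i) (y i))"
    and "{q. eigenvalue A q} = range (\<lambda>i. Dual (l i) (b i))"
proof -
  let ?M = "map_matrix st A" and ?B = "map_matrix du A"
  \<comment> \<open>A diagonalization from any one index suffices: it only serves to show that the
    given \<open>x\<close> form an eigenbasis.\<close>
  obtain U d where U: "diagonalizes ?M U d"
    using simple unfolding simple_right_eigenvalue_def by blast
  have "l i \<in> range of_real" for i
    using simple[of i] unfolding simple_right_eigenvalue_def by (metis rangeI)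
  then have "\<forall>i. \<exists>r. l i = of_real r" by blast
  then obtain e where l: "\<And>i. l i = of_real (e i)" by metis
  have "inj e" using \<open>inj l\<close> by (simp add: inj_def l)
  then have uniq: "j = i" if "e j = e i" for i j
    using that by (simp add: inj_eq)
  have Mx: "?M *v x i = rscale (x i) (of_real (e i))" and nz: "x i \<noteq> 0" for i
    using x[of i] by (simp_all add: right_eigenpair_def l)
  interpret eigenbasis ?M x e
    using eigenbasis.distinct_eigenvectors_eigenbasis[OF diagonalizes_eigenbasis[OF U] \<open>inj e\<close> Mx unit] .
  have B: "hermitian ?B" by (rule hermitian_map_matrix[OF assms(1)])
  have b: "b i \<in> \<real>" for i
    unfolding b_def by (rule hermitian_cdot_real[OF B])
  show pair: "eigenpair A (Dual (l i) (b i)) (dual_vec (x i) (y i))" for i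
  proof -
    have "cdot (x i) (?B *v x i - rscale (x i) (b i)) = 0"
      by (simp add: cdot_diff cdot_rscale orth b_def)
    \<comment> \<open>By \<open>outer_mult\<close>, \<open>y i\<close> is exactly the sum built in
      \<open>first_order_solution\<close>.\<close>
    from first_order_solution[OF uniq this]
    have "?M *v y i + (?B *v x i - rscale (x i) (b i)) = rscale (y i) (of_real (e i))"
      by (simp add: y_def matrix_sub_mat_mult[OF b] outer_mult rscale_rscale l)
    then have "?M *v y i + ?B *v x i = rscale (x i) (b i) + rscale (y i) (of_real (e i))"
      by (simp add: algebra_simps)
    with b Mx nz show ?thesis
      by (auto simp: eigenpair_dual_vec l)
  qed
  show "{q. eigenvalue A q} = range (\<lambda>i. Dual (l i) (b i))"
  proof (intro equalityI subsetI)
    fix q assume "q \<in> {q. eigenvalue A q}"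
    then obtain z where "eigenpair A q z" by (auto simp: eigenvalue_def)
    moreover obtain v w where "z = dual_vec v w" by (rule dual_vec_cases)
    moreover obtain a c where q: "q = Dual a c" by (cases q)
    ultimately have *: "a \<in> \<real>" "v \<noteq> 0" "?M *v v = rscale v a"
      "?M *v w + ?B *v v = rscale v c + rscale w a"
      by (simp_all add: eigenpair_dual_vec)
    \<comment> \<open>No further eigenvalues: by completeness the real standard part must be some
      \<open>e i\<close>, and \<open>first_order_value\<close> then forces the dual part, whichever
      eigenvector was used.\<close>
    from \<open>a \<in> \<real>\<close> obtain r where r: "a = of_real r" by (rule Reals_cases)
    then obtain i where i: "r = e i"
      using real_eigenvalue_in_range[of v r] * by auto
    have "c = b i"
      unfolding b_def by (rule first_order_value[OF uniq B \<open>v \<noteq> 0\<close>]) (use * r i in auto)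
    then show "q \<in> range (\<lambda>i. Dual (l i) (b i))"
      by (auto simp: q r i l)
  next
    fix q assume "q \<in> range (\<lambda>i. Dual (l i) (b i))"
    then show "q \<in> {q. eigenvalue A q}" using pair by (auto simp: eigenvalue_def)
  qed
qed

text \<open>Injectivity of \<open>l_st\<close> expresses that the simple right eigenvalues are
  \<open>n\<close> different ones. "Exactly \<open>n\<close>" is rendered by the full set of
  eigenvalues together with its cardinality.\<close>

theorem theorem3p4:
  fixes A :: "quat dual ^ 'n ^ 'n" and A_st A_I :: "quat ^ 'n ^ 'n"
  assumes "A_st = map_matrix st A" and "A_I = map_matrix du A"
    and "hermitian A" and "A_st \<noteq> 0"
  shows "(\<forall>l_st x_st. simple_right_eigenvalue A_st l_st \<and> right_eigenpair A_st l_st x_st \<longrightarrow>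
            eigenvalue A (Dual l_st (cdot x_st (A_I *v x_st) / cdot x_st x_st)))
       \<and> (\<forall>(l_st :: 'n \<Rightarrow> quat) (x_st :: 'n \<Rightarrow> quat ^ 'n) l_I x_I.
            inj l_st
            \<and> (\<forall>i. simple_right_eigenvalue A_st (l_st i)
                 \<and> right_eigenpair A_st (l_st i) (x_st i) \<and> cdot (x_st i) (x_st i) = 1)
            \<and> (\<forall>i. l_I i = cdot (x_st i) (A_I *v x_st i))
            \<and> (\<forall>i. x_I i = (\<Sum>j\<in>UNIV - {i}.
                 rscale (outer (x_st j) (x_st j) *v ((A_I - mat (l_I i)) *v x_st i))
                        (inverse (l_st i - l_st j))))
            \<longrightarrow>
            (\<forall>i. eigenpair A (Dual (l_st i) (l_I i)) (dual_vec (x_st i) (x_I i)))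
            \<and> {l. eigenvalue A l} = range (\<lambda>i. Dual (l_st i) (l_I i))
            \<and> card {l. eigenvalue A l} = CARD('n))"
proof (intro conjI allI impI; (elim conjE)?)
  show "eigenvalue A (Dual l_st (cdot x_st (A_I *v x_st) / cdot x_st x_st))"
    if "simple_right_eigenvalue A_st l_st" "right_eigenpair A_st l_st x_st" for l_st x_st
    using simple_right_eigenvalue_eigenvalue[OF \<open>hermitian A\<close>] that assms(1,2) by simp
next
  fix l_st :: "'n \<Rightarrow> quat" and x_st :: "'n \<Rightarrow> quat ^ 'n" and l_I x_I
  assume l: "inj l_st"
    and x: "\<forall>i. simple_right_eigenvalue A_st (l_st i)
      \<and> right_eigenpair A_st (l_st i) (x_st i) \<and> cdot (x_st i) (x_st i) = 1"
    and l_I: "\<forall>i. l_I i = cdot (x_st i) (A_I *v x_st i)"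
    and x_I: "\<forall>i. x_I i = (\<Sum>j\<in>UNIV - {i}.
      rscale (outer (x_st j) (x_st j) *v ((A_I - mat (l_I i)) *v x_st i)) (inverse (l_st i - l_st j)))"
  note * = simple_right_eigenvalues_eigenvalues[OF \<open>hermitian A\<close> l, of x_st,
      folded assms(1,2), folded l_I[rule_format], folded x_I[rule_format]]
  show "eigenpair A (Dual (l_st i) (l_I i)) (dual_vec (x_st i) (x_I i))" for i
    using x by (intro *) auto
  show spec: "{l. eigenvalue A l} = range (\<lambda>i. Dual (l_st i) (l_I i))"
    using x by (intro *) auto
  \<comment> \<open>The standard parts alone already separate the dual eigenvalues.\<close>
  have "inj (\<lambda>i. Dual (l_st i) (l_I i))"
    using l by (simp add: inj_def)
  then show "card {l. eigenvalue A l} = CARD('n)"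
    by (simp add: spec card_image)
qed

end
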